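(* Let $(L,[p])$ be a finite-dimensional restricted Leibniz algebra over a field $\mathbb{F}$ of prime characteristic $p$ and let $H\subseteq L$ be a subalgebra of $L$. If there exists a maximal torus $T\subseteq L$ such that $H=Z_L(T)=C_L(T)$, then $H$ is a Cartan subalgebra of $L$.
   Context: A (left) Leibniz algebra over $\mathbb{F}$ is an $\mathbb{F}$-vector space $L$ with a bilinear bracket satisfying $[[x,y],z]=[x,[y,z]]-[y,[x,z]]$ for all $x,y,z\in L$; $L_a(x)=[a,x]$ denotes left multiplication. A restricted Leibniz algebra $(L,[p])$ is a Leibniz algebra $L$ with a $p$-mapping $[p]:L\to L$, $a\mapsto a^{[p]}$, i.e. a mapping such that for all $a,b\in L$, $\alpha\in\mathbb{F}$: (i) $L_{a^{[p]}}=(L_a)^p$; (ii) $(\alpha a)^{[p]}=\alpha^pa^{[p]}$; (iii) $(a+b)^{[p]}=a^{[p]}+b^{[p]}+\sum_{i=1}^{p-1}s_i(a,b)$, where $(L(a\otimes X+b\otimes1))^{p-1}(a\otimes 1)=\sum_{i=1}^{p-1}i\,s_i(a,b)\otimes X^{i-1}$ in $L\otimes_{\mathbb{F}}\mathbb{F}[X]$ (with bracket $[a\otimes f,b\otimes g]=[a,b]\otimes fg$, and $L(u)$ denoting left multiplication by $u$). $x^{[p]^i}$ denotes the image of $x$ under the $i$-th iterate of $[p]$. A subalgebra is a subspace $H$ with $[H,H]\subseteq H$; a $p$-subalgebra is a subalgebra $H$ with $x^{[p]}\in H$ for all $x\in H$. An element $x\in L$ is semisimple if $x=\sum_{i=1}^m\alpha_i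 x^{[p]^i}$ for some $m\ge1$, $\alpha_i\in\mathbb{F}$. A torus is a $p$-subalgebra $T\subseteq L$ which is abelian ($[T,T]=0$) and all of whose elements are semisimple; a maximal torus is one maximal with respect to inclusion among tori of $L$. For $S\subseteq L$: $Z_L(S)=\{x\in L\mid [x,S]=0\}$ and $C_L(S)=\{x\in L\mid [S,x]=0\}$. For a subspace $V\subseteq L$: $\mathrm{Nor}_L(V)=\{x\in L\mid [V,x]\subseteq V\}$. A Leibniz algebra $H$ is nilpotent if $H^t=0$ for some $t\geq 1$, where $H^1=H$, $H^{n+1}=[H,H^n]$. A Cartan subalgebra of $L$ is a nilpotent subalgebra $H$ with $\mathrm{Nor}_L(H)=H$. *)

theory Defs
  imports "HOL-Computational_Algebra.Computational_Algebra"
begin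

text \<open>Left Leibniz algebras: the carrier is a whole type, the field acts by \<open>scale\<close>.\<close>

locale leibniz_algebra = vector_space scale
  for scale :: "'f::field \<Rightarrow> 'l::ab_group_add \<Rightarrow> 'l" (infixr "*s" 75) +
  fixes bracket :: "'l \<Rightarrow> 'l \<Rightarrow> 'l" ("\<lbrakk>_,/ _\<rbrakk>")
  assumes linear_right: "Vector_Spaces.linear (*s) (*s) (\<lambda>y. \<lbrakk>x, y\<rbrakk>)"
    and linear_left: "Vector_Spaces.linear (*s) (*s) (\<lambda>x. \<lbrakk>x, y\<rbrakk>)"
    and left_leibniz: "\<lbrakk>\<lbrakk>x, y\<rbrakk>, z\<rbrakk> = \<lbrakk>x, \<lbrakk>y, z\<rbrakk>\<rbrakk> - \<lbrakk>y, \<lbrakk>x, z\<rbrakk>\<rbrakk>"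
begin

definition finite_dimensional :: bool where
  "finite_dimensional \<longleftrightarrow> (\<exists>B. finite B \<and> span B = UNIV)"

definition subalgebra :: "'l set \<Rightarrow> bool" where
  "subalgebra H \<longleftrightarrow> subspace H \<and> (\<forall>x\<in>H. \<forall>y\<in>H. \<lbrakk>x, y\<rbrakk> \<in> H)"

definition set_bracket :: "'l set \<Rightarrow> 'l set \<Rightarrow> 'l set" where
  "set_bracket A B = span {\<lbrakk>a, b\<rbrakk> | a b. a \<in> A \<and> b \<in> B}"

text \<open>The exponent is shifted by one: \<open>lower_series H n\<close> is $H^{n+1}$.\<close>

primrec lower_series :: "'l set \<Rightarrow> nat \<Rightarrow> 'l set" where
  "lower_series H 0 = H"
| "lower_series H (Suc n) = set_bracket H (lower_series H n)"

definition nilpotent :: "'l set \<Rightarrow> bool" where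
  "nilpotent H \<longleftrightarrow> (\<exists>n. lower_series H n = {0})"

definition left_centralizer :: "'l set \<Rightarrow> 'l set" where  \<comment> \<open>$Z_L(S)$\<close>
  "left_centralizer S = {x. \<forall>s\<in>S. \<lbrakk>x, s\<rbrakk> = 0}"

definition right_centralizer :: "'l set \<Rightarrow> 'l set" where  \<comment> \<open>$C_L(S)$\<close>
  "right_centralizer S = {x. \<forall>s\<in>S. \<lbrakk>s, x\<rbrakk> = 0}"

definition normalizer :: "'l set \<Rightarrow> 'l set" where  \<comment> \<open>one-sided, as the bracket is not antisymmetric\<close>
  "normalizer V = {x. \<forall>v\<in>V. \<lbrakk>v, x\<rbrakk> \<in> V}"

definition cartan_subalgebra :: "'l set \<Rightarrow> bool" where
  "cartan_subalgebra H \<longleftrightarrow> subalgebra H \<and> nilpotent H \<and> normalizer H = H"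

text \<open>
  \<open>L \<otimes> F[X]\<close> is modelled by polynomials with coefficients in \<open>L\<close>, where \<open>a \<otimes> X^i\<close> is
  \<open>monom a i\<close>; the bracket is the bilinear extension of
  \<open>[a \<otimes> X^i, b \<otimes> X^j] = [a, b] \<otimes> X^(i+j)\<close>.
\<close>

definition poly_bracket :: "'l poly \<Rightarrow> 'l poly \<Rightarrow> 'l poly" where
  "poly_bracket u v =
     (\<Sum>i\<le>degree u. \<Sum>j\<le>degree v. monom \<lbrakk>coeff u i, coeff v j\<rbrakk> (i + j))"

text \<open>
  The identity defining \<open>s\<^sub>1, \<dots>, s\<^sub>p\<^sub>-\<^sub>1\<close>. In characteristic \<open>p\<close> it determines these
  elements; other values of \<open>s\<close> are irrelevant. It includes the vanishing of the coefficient
  of \<open>X^(p-1)\<close> on the left-hand side, which is \<open>(L_a)^(p-1) a\<close>. This is no extra restriction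
  on a p-mapping: reading off the \<open>s\<^sub>i\<close> from the lower coefficients only, the homogeneity and
  additivity laws for \<open>a\<close> and its multiples by the prime field already force
  \<open>(L_a)^(p-1) a = 0\<close>.
\<close>

definition jacobson_terms :: "nat \<Rightarrow> 'l \<Rightarrow> 'l \<Rightarrow> (nat \<Rightarrow> 'l) \<Rightarrow> bool" where
  "jacobson_terms p a b s \<longleftrightarrow>
     (poly_bracket (monom a 1 + monom b 0) ^^ (p - 1)) (monom a 0) =
       (\<Sum>i = 1..p - 1. monom (of_nat i *s s i) (i - 1))"

end

locale restricted_leibniz_algebra = leibniz_algebra scale bracket
  for scale :: "'f::field \<Rightarrow> 'l::ab_group_add \<Rightarrow> 'l" (infixr "*s" 75)
    and bracket :: "'l \<Rightarrow> 'l \<Rightarrow> 'l" ("\<lbrakk>_,/ _\<rbrakk>") +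
  fixes p :: nat
    and pmap :: "'l \<Rightarrow> 'l"
  assumes prime_p: "prime p"
    and char_p: "CHAR('f) = p"
    and left_mult_pmap: "bracket (pmap a) = bracket a ^^ p"
    and pmap_scale: "pmap (\<alpha> *s a) = \<alpha> ^ p *s pmap a"
    and pmap_add:
      "\<exists>s. jacobson_terms p a b s \<and>
           pmap (a + b) = pmap a + pmap b + (\<Sum>i = 1..p - 1. s i)"
begin

definition p_subalgebra :: "'l set \<Rightarrow> bool" where
  "p_subalgebra H \<longleftrightarrow> subalgebra H \<and> (\<forall>x\<in>H. pmap x \<in> H)"

definition semisimple :: "'l \<Rightarrow> bool" where
  "semisimple x \<longleftrightarrow>
     (\<exists>m\<ge>1. \<exists>\<alpha> :: nat \<Rightarrow> 'f. x = (\<Sum>i = 1..m. \<alpha> i *s (pmap ^^ i) x))"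

definition torus :: "'l set \<Rightarrow> bool" where
  "torus T \<longleftrightarrow> p_subalgebra T \<and> (\<forall>x\<in>T. \<forall>y\<in>T. \<lbrakk>x, y\<rbrakk> = 0) \<and> (\<forall>x\<in>T. semisimple x)"

definition maximal_torus :: "'l set \<Rightarrow> bool" where
  "maximal_torus T \<longleftrightarrow> torus T \<and> (\<forall>T'. torus T' \<and> T \<subseteq> T' \<longrightarrow> T' = T)"

end

end

theory Submission
  imports Defs
begin

text \<open>
  Write \<open>L\<^sub>x\<close> for left multiplication by \<open>x\<close> and let \<open>H = Z(T) = C(T)\<close> for a maximal torus \<open>T\<close>.
  Since \<open>T\<close> is abelian, \<open>T \<subseteq> H\<close>.

  The engine of the proof is that a semisimple \<open>a\<close> satisfies
  \<open>L\<^sub>a = \<Sum>i\<ge>1. \<alpha>\<^sub>i (L\<^sub>a)^(p^i)\<close>, so the kernels of \<open>L\<^sub>a\<close> and of all its powers agree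
  (\<open>semisimple_left_mult_kernel\<close>). If \<open>[H, x] \<subseteq> H\<close>, then \<open>L\<^sub>t\<close> kills \<open>[t, x] \<in> H = C(T)\<close> for every
  \<open>t \<in> T\<close>; hence \<open>L\<^sub>t x = 0\<close> already, so \<open>x \<in> C(T) = H\<close> and \<open>H\<close> is self-normalizing.

  For nilpotency, take \<open>x \<in> H\<close>. By finite dimension some iterate \<open>s\<close> of the p-mapping on \<open>x\<close> lies in the
  span of the later iterates, that is, \<open>s\<close> is semisimple, and \<open>s\<close> still centralizes \<open>T\<close>.
  The span of \<open>T\<close> and the iterates of \<open>s\<close> is again a torus (\<open>torus_adjoin_semisimple\<close>),
  so \<open>s \<in> T\<close> by maximality. As \<open>H = C(T)\<close>, the operator \<open>L\<^sub>s\<close>, which is a power of \<open>L\<^sub>x\<close>, vanishes on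
  \<open>H\<close>. So every \<open>L\<^sub>x\<close> with \<open>x \<in> H\<close> acts nilpotently on \<open>H\<close>, and Engel's theorem
  (\<open>engel\<close>) gives the result.

  Two points differ from the Lie case. In a Leibniz algebra \<open>[s, s]\<close> can be nonzero, so it must be shown
  that the iterates of \<open>s\<close> commute. The Jacobson formula for the pair \<open>(b, 0)\<close> says
  \<open>(L\<^sub>b)^(p-1) b = 0\<close>; for an iterate \<open>b\<close> of \<open>s\<close> this reads \<open>(L\<^sub>s)^N b = 0\<close> for some \<open>N\<close>, and semisimplicity of
  \<open>s\<close> improves it to \<open>L\<^sub>s b = 0\<close>. In Engel's theorem, the lack of antisymmetry is absorbed by working
  only with subalgebras that contain all elements acting as zero from the left.
\<close>

section \<open>Linear algebra\<close>

context finite_dimensional_vector_space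
begin

text \<open>
  The spans of the tails form a decreasing chain of subspaces, which becomes stationary.
\<close>

lemma sequence_term_in_span_of_later:
  fixes f :: "nat \<Rightarrow> 'b"
  shows "\<exists>r. f r \<in> span (f ` {r<..})"
proof -
  obtain r where r: "\<And>k. dim (f ` {r..}) \<le> dim (f ` {k..})"
    using ex_has_least_nat[of "\<lambda>_. True" 0 "\<lambda>k. dim (f ` {k..})"] by auto
  have sub: "span (f ` {r<..}) \<subseteq> span (f ` {r..})"
    by (intro span_mono image_mono) auto
  have "{r<..} = {Suc r..}" by auto
  then have "\<not> dim (f ` {r<..}) < dim (f ` {r..})"
    using r[of "Suc r"] by simp
  then have "span (f ` {r<..}) = span (f ` {r..})"
    using sub dim_psubset by blast
  then have "f r \<in> span (f ` {r<..})"
    using span_base[of "f r" "f ` {r..}"] by auto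
  then show ?thesis ..
qed

text \<open>
  A semilinear \<open>\<phi>\<close> whose image spans \<open>A\<close> carries a basis of \<open>A\<close> to a spanning set, hence by
  counting injectively to a linearly independent set. Applied to a basis that extends \<open>x\<close> together with a basis of
  \<open>W\<close>, this excludes \<open>\<phi> x \<in> span (\<phi> ` W)\<close> when \<open>x \<notin> W\<close>. The scalar twist \<open>\<sigma>\<close> is arbitrary;
  for the p-mapping it is the Frobenius map.
\<close>

lemma semilinear_reflects_span:
  fixes \<phi> :: "'b \<Rightarrow> 'b" and \<sigma> :: "'a \<Rightarrow> 'a"
  assumes A: "subspace A"
    and add: "\<And>u v. u \<in> A \<Longrightarrow> v \<in> A \<Longrightarrow> \<phi> (u + v) = \<phi> u + \<phi> v"
    and scale: "\<And>c u. u \<in> A \<Longrightarrow> \<phi> (scale c u) = scale (\<sigma> c) (\<phi> u)"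
    and zero: "\<phi> 0 = 0"
    and gen: "A \<subseteq> span (\<phi> ` A)"
    and W: "subspace W" "W \<subseteq> A"
    and x: "x \<in> A" "\<phi> x \<in> span (\<phi> ` W)"
  shows "x \<in> W"
proof (rule ccontr)
  assume "x \<notin> W"
  have image_span: "\<phi> ` span B \<subseteq> span (\<phi> ` B)" if "B \<subseteq> A" for B
  proof clarify
    fix w assume "w \<in> span B"
    then have "w \<in> A \<and> \<phi> w \<in> span (\<phi> ` B)"
    proof (induction rule: span_induct_alt)
      case base
      then show ?case using zero A by (simp add: subspace_0 span_zero)
    next
      case (step c u v)
      then have "u \<in> A" using that by auto
      moreover have "scale c u \<in> A" using A \<open>u \<in> A\<close> by (rule subspace_scale)
      ultimately show ?case using step A add scale
        by (auto intro!: span_add span_scale subspace_add simp: span_base)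
    qed
    then show "\<phi> w \<in> span (\<phi> ` B)" ..
  qed
  obtain B where B: "B \<subseteq> W" "independent B" "W \<subseteq> span B"
    using basis_exists by metis
  have "span B \<subseteq> W" using B(1) W(1) by (rule span_minimal)
  with \<open>x \<notin> W\<close> have "x \<notin> span B" by blast
  then have "independent (insert x B)" using B(2) by (simp add: independent_insertI)
  moreover have "insert x B \<subseteq> A" using x B W by auto
  ultimately obtain C where C: "insert x B \<subseteq> C" "C \<subseteq> A" "independent C" "A \<subseteq> span C"
    using maximal_independent_subset_extend[of "insert x B" A] by auto
  have finC: "finite C" using C(3) by (rule finiteI_independent)
  have cardC: "card C = dim A" using C by (metis basis_card_eq_dim)
  have "\<phi> ` A \<subseteq> span (\<phi> ` C)" using image_span[OF C(2)] C(4) by blast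
  then have "span (\<phi> ` A) \<subseteq> span (\<phi> ` C)"
    by (rule span_minimal) (rule subspace_span)
  with gen have gC: "A \<subseteq> span (\<phi> ` C)" by blast
  have "dim A \<le> card (\<phi> ` C)" using gC finC by (simp add: dim_le_card)
  moreover have "card (\<phi> ` C) \<le> card C" using finC by (rule card_image_le)
  ultimately have cards: "card (\<phi> ` C) = card C" using cardC by simp
  then have inj: "inj_on \<phi> C" using finC by (simp add: eq_card_imp_inj_on)
  have "dim A \<le> dim (\<phi> ` C)" using gC by (metis dim_subset dim_span)
  then have "independent (\<phi> ` C)"
    using cards cardC finC by (intro card_le_dim_spanning[of _ "span (\<phi> ` C)"]) (auto simp: span_superset)
  moreover have "\<phi> x \<in> span (\<phi> ` C - {\<phi> x})"
  proof -
    have "\<phi> ` B \<subseteq> \<phi> ` C - {\<phi> x}"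
      using inj C(1) \<open>x \<notin> W\<close> B(1) by (auto dest!: inj_onD[OF inj])
    moreover have "\<phi> ` W \<subseteq> span (\<phi> ` B)" using image_span[of B] B W by blast
    then have "span (\<phi> ` W) \<subseteq> span (\<phi> ` B)"
      by (rule span_minimal) (rule subspace_span)
    ultimately show ?thesis using x(2) span_mono by blast
  qed
  moreover have "\<phi> x \<in> \<phi> ` C" using C(1) by auto
  ultimately show False unfolding dependent_def by blast
qed

text \<open>
  Some \<open>\<phi>\<^sup>r x\<close> lies in the span of the later iterates; the previous lemma cancels one \<open>\<phi>\<close> at a time
  until \<open>r = 0\<close>. For the p-mapping the conclusion is semisimplicity of \<open>x\<close>, so this lemma
  replaces the argument that a sum of commuting semisimple elements is semisimple.
\<close>

lemma semilinear_orbit_in_span: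
  fixes \<phi> :: "'b \<Rightarrow> 'b" and \<sigma> :: "'a \<Rightarrow> 'a"
  assumes A: "subspace A"
    and add: "\<And>u v. u \<in> A \<Longrightarrow> v \<in> A \<Longrightarrow> \<phi> (u + v) = \<phi> u + \<phi> v"
    and scale: "\<And>c u. u \<in> A \<Longrightarrow> \<phi> (scale c u) = scale (\<sigma> c) (\<phi> u)"
    and zero: "\<phi> 0 = 0"
    and inv: "\<phi> ` A \<subseteq> A"
    and gen: "A \<subseteq> span (\<phi> ` A)"
    and x: "x \<in> A"
  shows "x \<in> span ((\<lambda>i. (\<phi> ^^ i) x) ` {0<..})"
proof -
  let ?f = "\<lambda>i. (\<phi> ^^ i) x"
  have fA: "?f i \<in> A" for i by (induction i) (use x inv in auto)
  obtain r where "?f r \<in> span (?f ` {r<..})"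
    using sequence_term_in_span_of_later[of ?f] ..
  then show ?thesis
  proof (induction r)
    case 0
    then show ?case by simp
  next
    case (Suc k)
    have eq: "?f ` {Suc k<..} = \<phi> ` (?f ` {k<..})"
    proof -
      have "{Suc k<..} = Suc ` {k<..}"
        by (auto simp: image_iff Suc_less_eq2)
      then show ?thesis by (simp add: image_image)
    qed
    have "\<phi> (?f k) \<in> span (\<phi> ` span (?f ` {k<..}))"
      using Suc.prems unfolding eq funpow.simps o_apply
      by (meson image_mono span_mono span_superset subsetD)
    moreover have "span (?f ` {k<..}) \<subseteq> A"
      using fA A by (intro span_minimal) auto
    ultimately have "?f k \<in> span (?f ` {k<..})"
      using semilinear_reflects_span[OF A add scale zero gen subspace_span _ fA] by blast
    then show ?case by (rule Suc.IH)
  qed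
qed

end

section \<open>The bracket and its extension to polynomials\<close>

context leibniz_algebra
begin

lemma bracket_add_right: "\<lbrakk>x, y + z\<rbrakk> = \<lbrakk>x, y\<rbrakk> + \<lbrakk>x, z\<rbrakk>"
  and bracket_scale_right: "\<lbrakk>x, c *s y\<rbrakk> = c *s \<lbrakk>x, y\<rbrakk>"
  and bracket_zero_right [simp]: "\<lbrakk>x, 0\<rbrakk> = 0"
proof -
  interpret r: Vector_Spaces.linear scale scale "\<lambda>y. \<lbrakk>x, y\<rbrakk>" by (rule linear_right)
  show "\<lbrakk>x, y + z\<rbrakk> = \<lbrakk>x, y\<rbrakk> + \<lbrakk>x, z\<rbrakk>" by (rule r.add)
  show "\<lbrakk>x, c *s y\<rbrakk> = c *s \<lbrakk>x, y\<rbrakk>" by (rule r.scale)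
  show "\<lbrakk>x, 0\<rbrakk> = 0" by (rule r.zero)
qed

lemma bracket_add_left: "\<lbrakk>x + y, z\<rbrakk> = \<lbrakk>x, z\<rbrakk> + \<lbrakk>y, z\<rbrakk>"
  and bracket_scale_left: "\<lbrakk>c *s x, z\<rbrakk> = c *s \<lbrakk>x, z\<rbrakk>"
  and bracket_zero_left [simp]: "\<lbrakk>0, z\<rbrakk> = 0"
  and bracket_sum_left: "\<lbrakk>sum g I, z\<rbrakk> = (\<Sum>i\<in>I. \<lbrakk>g i, z\<rbrakk>)"
proof -
  interpret r: Vector_Spaces.linear scale scale "\<lambda>x. \<lbrakk>x, z\<rbrakk>" by (rule linear_left)
  show "\<lbrakk>x + y, z\<rbrakk> = \<lbrakk>x, z\<rbrakk> + \<lbrakk>y, z\<rbrakk>" by (rule r.add)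
  show "\<lbrakk>c *s x, z\<rbrakk> = c *s \<lbrakk>x, z\<rbrakk>" by (rule r.scale)
  show "\<lbrakk>0, z\<rbrakk> = 0" by (rule r.zero)
  show "\<lbrakk>sum g I, z\<rbrakk> = (\<Sum>i\<in>I. \<lbrakk>g i, z\<rbrakk>)" by (rule r.sum)
qed

lemma funpow_bracket_zero [simp]: "(bracket x ^^ n) 0 = 0"
  by (induction n) auto

lemma funpow_bracket_eq_zero:
  assumes "\<lbrakk>x, y\<rbrakk> = 0" "n > 0"
  shows "(bracket x ^^ n) y = 0"
  using assms by (cases n) (simp_all add: funpow_Suc_right del: funpow.simps)

lemma bracket_span_in_subspace:
  assumes "subspace W" "\<And>b. b \<in> B \<Longrightarrow> \<lbrakk>x, b\<rbrakk> \<in> W" "y \<in> span B"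
  shows "\<lbrakk>x, y\<rbrakk> \<in> W"
  using assms(3)
proof (induction rule: span_induct_alt)
  case base
  then show ?case using assms(1) by (simp add: subspace_0)
next
  case (step c u v)
  then show ?case
    using assms by (auto simp: bracket_add_right bracket_scale_right intro: subspace_add subspace_scale)
qed

lemma poly_bracket_monom:
  "poly_bracket (monom a m) (monom b n) = monom \<lbrakk>a, b\<rbrakk> (m + n)"
proof (cases "a = 0 \<or> b = 0")
  case True
  then show ?thesis by (auto simp: poly_bracket_def)
next
  case False
  have "poly_bracket (monom a m) (monom b n) =
    (\<Sum>i\<le>m. \<Sum>j\<le>n. if j = n then (if i = m then monom \<lbrakk>a, b\<rbrakk> (m + n) else 0) else 0)"
    unfolding poly_bracket_def using False
    by (intro sum.cong) (auto simp: degree_monom_eq)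
  also have "\<dots> = monom \<lbrakk>a, b\<rbrakk> (m + n)"
    by (simp add: sum.delta)
  finally show ?thesis .
qed

end

section \<open>Engel's theorem for Leibniz algebras\<close>

context leibniz_algebra
begin

lemma set_bracket_mem: "a \<in> A \<Longrightarrow> b \<in> B \<Longrightarrow> \<lbrakk>a, b\<rbrakk> \<in> set_bracket A B"
  unfolding set_bracket_def by (rule span_base) blast

lemma set_bracket_subset:
  "subspace W \<Longrightarrow> (\<And>a b. a \<in> A \<Longrightarrow> b \<in> B \<Longrightarrow> \<lbrakk>a, b\<rbrakk> \<in> W) \<Longrightarrow> set_bracket A B \<subseteq> W"
  unfolding set_bracket_def by (rule span_minimal) blast

lemma lower_series_eq_funpow: "lower_series H n = (set_bracket H ^^ n) H"
  by (induction n) auto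

text \<open>
  The inductive step of Engel's theorem, without quotient spaces. Let \<open>U\<^sub>i\<close> be the iterated products
  \<open>[K, [K, \<dots>, H]]\<close>. They decrease, and they are stable under \<open>L\<^sub>x\<close> because \<open>L\<^sub>x\<close> is a derivation that maps \<open>K\<close>
  into itself. Modulo \<open>U\<^sub>i\<^sub>+\<^sub>1\<close>, every element of \<open>K + F x\<close> acts on \<open>U\<^sub>i\<close> as a multiple of \<open>L\<^sub>x\<close>, so
  \<open>N\<close> consecutive factors from \<open>K + F x\<close> push \<open>U\<^sub>i\<close> into \<open>U\<^sub>i\<^sub>+\<^sub>1\<close>.
\<close>

lemma acts_nilpotently_extend:
  assumes H: "subalgebra H" and K: "subspace K" "K \<subseteq> H"
    and x: "x \<in> H" "\<And>k. k \<in> K \<Longrightarrow> \<lbrakk>x, k\<rbrakk> \<in> K"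
    and nilK: "(set_bracket K ^^ n) H = {0}"
    and nilx: "\<And>y. y \<in> H \<Longrightarrow> (bracket x ^^ N) y = 0"
  shows "\<exists>m. (set_bracket (span (insert x K)) ^^ m) H = {0}"
proof -
  define U where "U i = (set_bracket K ^^ i) H" for i
  define K' where "K' = span (insert x K)"
  define W where "W j = (set_bracket K' ^^ j) H" for j
  have U_Suc: "U (Suc i) = set_bracket K (U i)" for i by (simp add: U_def)
  have W_Suc: "W (Suc i) = set_bracket K' (W i)" for i by (simp add: W_def)
  have subU: "subspace (U i)" for i
    using H by (cases i) (auto simp: U_def set_bracket_def subalgebra_def)
  have subW: "subspace (W i)" for i
    using H by (cases i) (auto simp: W_def set_bracket_def subalgebra_def)
  have dec: "U (Suc i) \<subseteq> U i" for i
  proof (induction i)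
    case 0
    show ?case unfolding U_Suc using H K
      by (intro set_bracket_subset subU) (auto simp: U_def subalgebra_def)
  next
    case (Suc i)
    show ?case unfolding U_Suc[of "Suc i"]
      using Suc by (intro set_bracket_subset subU) (auto simp: U_Suc intro: set_bracket_mem)
  qed
  have UH: "U i \<subseteq> H" for i
    by (induction i) (use dec in \<open>auto simp: U_def\<close>)
  have xU: "\<lbrakk>x, y\<rbrakk> \<in> U i" if "y \<in> U i" for y i
    using that
  proof (induction i arbitrary: y)
    case 0
    then show ?case using H x by (auto simp: U_def subalgebra_def)
  next
    case (Suc i)
    show ?case
    proof (rule bracket_span_in_subspace[OF subU])
      show "y \<in> span {\<lbrakk>a, b\<rbrakk> | a b. a \<in> K \<and> b \<in> U i}"
        using Suc.prems by (simp add: U_Suc set_bracket_def)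
    next
      fix z assume "z \<in> {\<lbrakk>a, b\<rbrakk> | a b. a \<in> K \<and> b \<in> U i}"
      then obtain a b where z: "z = \<lbrakk>a, b\<rbrakk>" "a \<in> K" "b \<in> U i" by blast
      have "\<lbrakk>x, z\<rbrakk> = \<lbrakk>\<lbrakk>x, a\<rbrakk>, b\<rbrakk> + \<lbrakk>a, \<lbrakk>x, b\<rbrakk>\<rbrakk>" by (simp add: z left_leibniz)
      then show "\<lbrakk>x, z\<rbrakk> \<in> U (Suc i)"
        using z x Suc.IH subU[of "Suc i"] by (auto simp: U_Suc intro!: subspace_add set_bracket_mem)
    qed
  qed
  have powU: "(bracket x ^^ m) y \<in> U i" if "y \<in> U i" for y i m
    by (induction m) (use that xU in auto)
  have step: "W (j + m) \<subseteq> span ((bracket x ^^ m) ` U i \<union> U (Suc i))" if "W j \<subseteq> U i" for i j m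
  proof (induction m)
    case 0
    then show ?case using that by (auto intro: span_base)
  next
    case (Suc m)
    let ?G = "\<lambda>m. (bracket x ^^ m) ` U i \<union> U (Suc i)"
    have "W (Suc (j + m)) \<subseteq> span (?G (Suc m))"
      unfolding W_Suc
    proof (rule set_bracket_subset[OF subspace_span])
      fix a w assume a: "a \<in> K'" and w: "w \<in> W (j + m)"
      obtain c where "a - c *s x \<in> span K"
        using a unfolding K'_def span_insert by blast
      then have k: "a - c *s x \<in> K" using K(1) by (metis span_eq_iff)
      define k where "k = a - c *s x"
      have ak: "a = c *s x + k" "k \<in> K" using k by (auto simp: k_def)
      show "\<lbrakk>a, w\<rbrakk> \<in> span (?G (Suc m))"
      proof (rule bracket_span_in_subspace[OF subspace_span])
        show "w \<in> span (?G m)" using w Suc by blast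
      next
        fix b assume b: "b \<in> ?G m"
        have "\<lbrakk>a, b\<rbrakk> = c *s \<lbrakk>x, b\<rbrakk> + \<lbrakk>k, b\<rbrakk>"
          by (simp add: ak bracket_add_left bracket_scale_left)
        moreover have "b \<in> U i" using b powU dec by blast
        then have "\<lbrakk>k, b\<rbrakk> \<in> U (Suc i)" using ak by (auto simp: U_Suc intro: set_bracket_mem)
        moreover have "\<lbrakk>x, b\<rbrakk> \<in> ?G (Suc m)" using b xU by auto
        ultimately show "\<lbrakk>a, b\<rbrakk> \<in> span (?G (Suc m))"
          by (auto intro!: span_add span_scale intro: span_base)
      qed
    qed
    then show ?case by simp
  qed
  \<comment> \<open>for \<open>m = N\<close> the first part of the spanning set vanishes: \<open>N\<close> steps of \<open>W\<close> gain one step of \<open>U\<close>\<close>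
  have "W (i * N) \<subseteq> U i" for i
  proof (induction i)
    case 0
    then show ?case by (simp add: U_def W_def)
  next
    case (Suc i)
    have "W (i * N + N) \<subseteq> span ((bracket x ^^ N) ` U i \<union> U (Suc i))"
      using Suc by (rule step)
    also have "\<dots> \<subseteq> U (Suc i)"
      using nilx UH subU[of "Suc i"] by (intro span_minimal subU) (auto simp: subspace_0 subset_iff)
    finally show ?case by (simp add: add.commute)
  qed
  then have "W (n * N) \<subseteq> {0}" using nilK by (auto simp: U_def)
  then have "W (n * N) = {0}" using subW[of "n * N"] subspace_0 by blast
  then show ?thesis unfolding W_def K'_def by blast
qed

text \<open>
  The iterated products \<open>[K, [K, \<dots>, H]]\<close> start at \<open>H\<close>, outside \<open>K\<close>, and end at \<open>0\<close>: an element of the last one not contained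
  in \<open>K\<close> will do.
\<close>

lemma exists_normalizing_element:
  assumes H: "subalgebra H" and K: "subspace K" "K \<subseteq> H" "K \<noteq> H"
    and nilK: "(set_bracket K ^^ n) H = {0}"
  shows "\<exists>x\<in>H - K. \<forall>k\<in>K. \<lbrakk>k, x\<rbrakk> \<in> K"
proof -
  define U where "U i = (set_bracket K ^^ i) H" for i
  have U_Suc: "U (Suc i) = set_bracket K (U i)" for i by (simp add: U_def)
  have UH: "U i \<subseteq> H" for i
  proof (induction i)
    case 0
    then show ?case by (simp add: U_def)
  next
    case (Suc i)
    then show ?case unfolding U_Suc using H K
      by (intro set_bracket_subset) (auto simp: subalgebra_def)
  qed
  have "U n \<subseteq> K" using nilK K by (simp add: U_def subspace_0)
  moreover have "\<not> U 0 \<subseteq> K" using K by (auto simp: U_def)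
  ultimately obtain i where "\<not> U i \<subseteq> K" "U (Suc i) \<subseteq> K"
    by (induction n) auto
  then obtain x where "x \<in> U i" "x \<notin> K" by blast
  then show ?thesis
    using UH \<open>U (Suc i) \<subseteq> K\<close> by (intro bexI[of _ x]) (auto simp: U_Suc intro: set_bracket_mem)
qed

end

locale finite_dimensional_leibniz_algebra =
  leibniz_algebra scale bracket + finite_dimensional_vector_space scale Basis
  for scale :: "'f::field \<Rightarrow> 'l::ab_group_add \<Rightarrow> 'l" (infixr "*s" 75)
    and bracket :: "'l \<Rightarrow> 'l \<Rightarrow> 'l" ("\<lbrakk>_,/ _\<rbrakk>")
    and Basis :: "'l set"
begin

text \<open>
  Take a subalgebra \<open>K\<close> of largest dimension among those that act nilpotently on \<open>H\<close> and contain the set \<open>Z\<close> of elements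
  acting as zero. If \<open>K \<noteq> H\<close>, a normalizing \<open>x\<close> outside \<open>K\<close> enlarges it. The preceding results
  provide only \<open>[K, x] \<subseteq> K\<close>, but the Leibniz identity puts \<open>[a, b] + [b, a]\<close> and \<open>[a, a]\<close> into \<open>Z\<close>; thus
  \<open>Z \<subseteq> K\<close> makes \<open>[x, K]\<close> and \<open>[x, x]\<close> lie in \<open>K\<close> as well, and \<open>K + F x\<close> is a subalgebra.
\<close>

theorem engel:
  assumes H: "subalgebra H"
    and nil: "\<And>x. x \<in> H \<Longrightarrow> \<exists>n. \<forall>y\<in>H. (bracket x ^^ n) y = 0"
  shows "nilpotent H"
proof -
  define Z where "Z = {z \<in> H. \<forall>y\<in>H. \<lbrakk>z, y\<rbrakk> = 0}"
  define P where "P K \<longleftrightarrow> subalgebra K \<and> Z \<subseteq> K \<and> K \<subseteq> H \<and>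
    (\<exists>n. (set_bracket K ^^ n) H = {0})" for K
  have HS: "subspace H" and HB: "\<And>x y. x \<in> H \<Longrightarrow> y \<in> H \<Longrightarrow> \<lbrakk>x, y\<rbrakk> \<in> H"
    using H by (auto simp: subalgebra_def)
  have symm: "\<lbrakk>a, b\<rbrakk> + \<lbrakk>b, a\<rbrakk> \<in> Z" if "a \<in> H" "b \<in> H" for a b
    using that HB HS by (auto simp: Z_def bracket_add_left left_leibniz intro: subspace_add)
  have square: "\<lbrakk>a, a\<rbrakk> \<in> Z" if "a \<in> H" for a
    using that HB by (auto simp: Z_def left_leibniz)
  have "P Z"
  proof -
    have "subspace Z"
      using HS by (auto simp: Z_def bracket_add_left bracket_scale_left
          intro!: subspaceI intro: subspace_0 subspace_add subspace_scale)
    moreover have "set_bracket Z H \<subseteq> {0}"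
      by (rule set_bracket_subset) (auto simp: Z_def)
    then have "set_bracket Z H = {0}"
      unfolding set_bracket_def using span_zero by blast
    then have "(set_bracket Z ^^ 1) H = {0}" by simp
    ultimately show ?thesis
      unfolding P_def subalgebra_def
      by (intro conjI exI[of _ 1]) (auto simp: Z_def subspace_0[OF HS])
  qed
  moreover have "\<forall>K. P K \<longrightarrow> dim K < Suc dimension"
    using dim_subset_UNIV by (auto simp: less_Suc_eq_le)
  ultimately obtain K where PK: "P K" and max: "\<And>K'. P K' \<Longrightarrow> dim K' \<le> dim K"
    using ex_has_greatest_nat[of P Z dim "Suc dimension"] by metis
  then obtain n where K: "subspace K" "\<And>a b. a \<in> K \<Longrightarrow> b \<in> K \<Longrightarrow> \<lbrakk>a, b\<rbrakk> \<in> K"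
    "Z \<subseteq> K" "K \<subseteq> H" "(set_bracket K ^^ n) H = {0}"
    by (auto simp: P_def subalgebra_def)
  have "K = H"
  proof (rule ccontr)
    assume "K \<noteq> H"
    then obtain x where x: "x \<in> H" "x \<notin> K" "\<And>k. k \<in> K \<Longrightarrow> \<lbrakk>k, x\<rbrakk> \<in> K"
      using exists_normalizing_element[OF H K(1,4) _ K(5)] by blast
    have xk: "\<lbrakk>x, k\<rbrakk> \<in> K" if "k \<in> K" for k
    proof -
      have "\<lbrakk>x, k\<rbrakk> + \<lbrakk>k, x\<rbrakk> \<in> K" using symm[of x k] x(1) that K(3,4) by blast
      then have "\<lbrakk>x, k\<rbrakk> + \<lbrakk>k, x\<rbrakk> - \<lbrakk>k, x\<rbrakk> \<in> K" using x(3)[OF that] by (rule subspace_diff[OF K(1)])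
      then show ?thesis by simp
    qed
    have xx: "\<lbrakk>x, x\<rbrakk> \<in> K" using square[OF x(1)] K(3) by blast
    let ?K' = "span (insert x K)"
    have K'K: "\<lbrakk>a, b\<rbrakk> \<in> K" if "a \<in> ?K'" "b \<in> ?K'" for a b
    proof (rule bracket_span_in_subspace[OF K(1) _ that(2)])
      fix b assume b: "b \<in> insert x K"
      show "\<lbrakk>a, b\<rbrakk> \<in> K"
        using that(1)
      proof (induction rule: span_induct_alt)
        case base
        then show ?case using K by (simp add: subspace_0)
      next
        case (step c u v)
        then have "\<lbrakk>u, b\<rbrakk> \<in> K" using b x xk xx K by auto
        then show ?case using step K
          by (auto simp: bracket_add_left bracket_scale_left intro: subspace_add subspace_scale)
      qed
    qed
    have KK': "K \<subseteq> ?K'" by (auto intro: span_base)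
    have "?K' \<subseteq> H" using x K HS by (intro span_minimal) auto
    obtain N where "\<forall>y\<in>H. (bracket x ^^ N) y = 0" using nil x by blast
    then have "\<exists>m. (set_bracket ?K' ^^ m) H = {0}"
      using acts_nilpotently_extend[OF H K(1,4) x(1) xk K(5)] by blast
    then have "P ?K'"
      using KK' K'K K(3) \<open>?K' \<subseteq> H\<close> by (auto simp: P_def subalgebra_def)
    then have "dim ?K' \<le> dim K" by (rule max)
    moreover have "x \<in> ?K'" by (auto intro: span_base)
    then have "span K \<subset> span ?K'" using KK' x K(1)
      by (metis psubsetI span_eq_iff span_span)
    then have "dim K < dim ?K'" by (rule dim_psubset)
    ultimately show False by simp
  qed
  then show ?thesis using K(5) by (auto simp: nilpotent_def lower_series_eq_funpow)
qed

end

section \<open>The p-mapping and semisimple elements\<close>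

context restricted_leibniz_algebra
begin

lemma p_ge_2: "p \<ge> 2"
  using prime_p by (rule prime_ge_2_nat)

lemma pmap_zero [simp]: "pmap 0 = 0"
  using pmap_scale[of 0 0] p_ge_2 by (simp add: power_0_left)

lemma left_mult_pmap_iter: "bracket ((pmap ^^ i) a) = bracket a ^^ (p ^ i)"
proof (induction i)
  case (Suc i)
  then show ?case by (simp add: left_mult_pmap funpow_mult mult.commute)
qed auto

text \<open>
  In the Jacobson formula for the pair \<open>(a, 0)\<close> the left-hand side is \<open>(L\<^sub>a)^(p-1) a \<otimes> X^(p-1)\<close>, while the
  right-hand side has degree at most \<open>p - 2\<close>. This is what remains in a restricted Leibniz
  algebra of the Lie identity \<open>[a, a] = 0\<close>.
\<close>

lemma left_mult_power_self: "(bracket a ^^ (p - 1)) a = 0"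
proof -
  obtain s where s: "jacobson_terms p a 0 s" using pmap_add by blast
  have "(poly_bracket (monom a 1) ^^ k) (monom a 0) = monom ((bracket a ^^ k) a) k" for k
    by (induction k) (auto simp: poly_bracket_monom)
  with s have "monom ((bracket a ^^ (p - 1)) a) (p - 1) =
      (\<Sum>i = 1..p - 1. monom (of_nat i *s s i) (i - 1))"
    by (simp add: jacobson_terms_def)
  then have "coeff (monom ((bracket a ^^ (p - 1)) a) (p - 1)) (p - 1) =
      (\<Sum>i = 1..p - 1. coeff (monom (of_nat i *s s i) (i - 1)) (p - 1))"
    by (simp add: coeff_sum)
  also have "\<dots> = 0" by (intro sum.neutral) auto
  finally show ?thesis by simp
qed

text \<open>
  Under these assumptions the first multiplication in the Jacobson formula already gives zero, so each \<open>i s\<^sub>i\<close>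
  vanishes, and \<open>i\<close> is invertible for \<open>0 < i < p\<close>.
\<close>

lemma pmap_add_commuting:
  assumes "\<lbrakk>a, a\<rbrakk> = 0" "\<lbrakk>b, a\<rbrakk> = 0"
  shows "pmap (a + b) = pmap a + pmap b"
proof -
  obtain s where s: "jacobson_terms p a b s"
    and sum: "pmap (a + b) = pmap a + pmap b + (\<Sum>i = 1..p - 1. s i)"
    using pmap_add by blast
  let ?u = "monom a 1 + monom b 0"
  have first: "poly_bracket ?u (monom a 0) = 0"
    unfolding poly_bracket_def using assms by (intro sum.neutral ballI) auto
  have zero: "(poly_bracket ?u ^^ k) 0 = 0" for k
    by (induction k) (auto simp: poly_bracket_def)
  obtain k where k: "p - 1 = Suc k" using p_ge_2 by (cases "p - 1") auto
  have "(poly_bracket ?u ^^ (p - 1)) (monom a 0) = 0"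
    unfolding k funpow_Suc_right o_apply first by (rule zero)
  with s have eq: "(\<Sum>i = 1..p - 1. monom (of_nat i *s s i) (i - 1)) = 0"
    by (simp add: jacobson_terms_def)
  have "s j = 0" if j: "j \<in> {1..p - 1}" for j
  proof -
    have "0 = (\<Sum>i = 1..p - 1. coeff (monom (of_nat i *s s i) (i - 1)) (j - 1))"
      using arg_cong[OF eq, of "\<lambda>q. coeff q (j - 1)"] by (simp add: coeff_sum)
    also have "\<dots> = (\<Sum>i = 1..p - 1. if i = j then of_nat i *s s i else 0)"
      using j by (intro sum.cong) auto
    also have "\<dots> = of_nat j *s s j" using j by simp
    finally have "of_nat j *s s j = 0" by simp
    moreover have "of_nat j \<noteq> (0 :: 'f)"
      using j char_p by (auto simp: of_nat_eq_0_iff_char_dvd dest: dvd_imp_le)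
    ultimately show "s j = 0" by simp
  qed
  then show ?thesis using sum by simp
qed

lemma semisimple_iff_in_span:
  "semisimple x \<longleftrightarrow> x \<in> span ((\<lambda>i. (pmap ^^ i) x) ` {0<..})"
proof -
  let ?f = "\<lambda>i. (pmap ^^ i) x"
  have "\<exists>m\<ge>1. \<exists>\<alpha>. y = (\<Sum>i = 1..m. \<alpha> i *s ?f i)" if "y \<in> span (?f ` {0<..})" for y
    using that
  proof (induction rule: span_induct_alt)
    case base
    show ?case by (intro exI[of _ 1] exI[of _ "\<lambda>_. 0"]) auto
  next
    case (step c u v)
    then obtain k where k: "k \<ge> 1" "u = ?f k" by (auto simp: Suc_le_eq)
    from step obtain m \<alpha> where m: "m \<ge> 1" "v = (\<Sum>i = 1..m. \<alpha> i *s ?f i)" by blast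
    let ?M = "max m k"
    have "c *s u = (\<Sum>i = 1..?M. (if i = k then c *s ?f i else 0))"
      using k by simp
    moreover have "v = (\<Sum>i = 1..?M. (if i \<le> m then \<alpha> i *s ?f i else 0))"
      unfolding m(2) by (intro sum.mono_neutral_cong_left) auto
    ultimately have "c *s u + v =
        (\<Sum>i = 1..?M. ((if i = k then c else 0) + (if i \<le> m then \<alpha> i else 0)) *s ?f i)"
      by (simp only: sum.distrib[symmetric]) (auto simp: scale_left_distrib intro!: sum.cong)
    then show ?case using m(1)
      by (intro exI[of _ ?M] conjI exI[of _ "\<lambda>i. (if i = k then c else 0) + (if i \<le> m then \<alpha> i else 0)"])
        auto
  qed
  moreover have "x \<in> span (?f ` {0<..})" if "semisimple x"
  proof -
    obtain m \<alpha> where "x = (\<Sum>i = 1..m. \<alpha> i *s ?f i)"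
      using \<open>semisimple x\<close> unfolding semisimple_def by blast
    also have "\<dots> \<in> span (?f ` {0<..})" by (intro span_sum span_scale span_base) auto
    finally show ?thesis .
  qed
  ultimately show ?thesis unfolding semisimple_def by blast
qed

text \<open>
  A semisimple \<open>a\<close> has \<open>L\<^sub>a = \<Sum>i\<ge>1. \<alpha>\<^sub>i (L\<^sub>a)^(p^i)\<close> with all exponents at least 2; hence
  \<open>(L\<^sub>a)\<^sup>2 z = 0\<close> implies \<open>L\<^sub>a z = 0\<close>, and higher powers reduce to this case.
\<close>

lemma semisimple_left_mult_kernel:
  assumes "semisimple a" "(bracket a ^^ n) y = 0"
  shows "\<lbrakk>a, y\<rbrakk> = 0"
proof -
  obtain m \<alpha> where a: "a = (\<Sum>i = 1..m. \<alpha> i *s (pmap ^^ i) a)"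
    using assms(1) unfolding semisimple_def by blast
  have twice: "\<lbrakk>a, z\<rbrakk> = 0" if "\<lbrakk>a, \<lbrakk>a, z\<rbrakk>\<rbrakk> = 0" for z
  proof -
    have "(bracket a ^^ (p ^ i)) z = 0" if "i \<in> {1..m}" for i
    proof -
      have "p ^ 1 \<le> p ^ i" using that p_ge_2 by (intro power_increasing) auto
      then obtain k where "p ^ i = k + 2" using p_ge_2
        by (metis add.commute le_Suc_ex le_trans power_one_right)
      then have "(bracket a ^^ (p ^ i)) z = (bracket a ^^ k) \<lbrakk>a, \<lbrakk>a, z\<rbrakk>\<rbrakk>"
        by (simp only: funpow_add o_apply) (simp add: numeral_2_eq_2)
      then show ?thesis using \<open>\<lbrakk>a, \<lbrakk>a, z\<rbrakk>\<rbrakk> = 0\<close> by simp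
    qed
    then have "\<lbrakk>(\<Sum>i = 1..m. \<alpha> i *s (pmap ^^ i) a), z\<rbrakk> = 0"
      by (simp add: bracket_sum_left bracket_scale_left left_mult_pmap_iter)
    with a show ?thesis by simp
  qed
  show ?thesis
    using assms(2)
  proof (induction n)
    case 0
    then show ?case by simp
  next
    case (Suc n)
    show ?case
    proof (cases n)
      case 0
      then show ?thesis using Suc.prems by simp
    next
      case (Suc k)
      then show ?thesis using Suc.prems Suc.IH twice by simp
    qed
  qed
qed

text \<open>
  For an iterate \<open>y\<close> of \<open>x\<close>, the identity \<open>(L\<^sub>y)^(p-1) y = 0\<close> says that a power of \<open>L\<^sub>x\<close> kills \<open>y\<close>. Since \<open>x\<close> is
  semisimple, \<open>L\<^sub>x\<close> itself kills \<open>y\<close>, and so does the left multiplication by any iterate of \<open>x\<close>, being a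
  positive power of \<open>L\<^sub>x\<close>.
\<close>

lemma semisimple_powers_commute:
  assumes "semisimple x"
  shows "\<lbrakk>(pmap ^^ i) x, (pmap ^^ j) x\<rbrakk> = 0"
proof -
  let ?y = "(pmap ^^ j) x"
  have "(bracket x ^^ (p ^ j * (p - 1))) ?y = (bracket ?y ^^ (p - 1)) ?y"
    by (simp add: left_mult_pmap_iter funpow_mult mult.commute)
  then have "\<lbrakk>x, ?y\<rbrakk> = 0"
    using left_mult_power_self semisimple_left_mult_kernel[OF assms] by simp
  then show ?thesis
    using p_ge_2 by (simp add: left_mult_pmap_iter funpow_bracket_eq_zero)
qed

lemma pmap_left_centralizer:
  assumes "x \<in> left_centralizer T"
  shows "(pmap ^^ i) x \<in> left_centralizer T"
  using assms p_ge_2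
  by (simp add: left_centralizer_def left_mult_pmap_iter funpow_bracket_eq_zero)

text \<open>
  If \<open>x\<close> normalizes \<open>H\<close> and \<open>t \<in> T\<close>, then \<open>[t, x] \<in> H = C(T)\<close>, so \<open>(L\<^sub>t)\<^sup>2 x = 0\<close>; semisimplicity of \<open>t\<close> gives
  \<open>L\<^sub>t x = 0\<close>.
\<close>

lemma normalizer_centralizer_subset:
  assumes "torus T" "T \<subseteq> H" "H = right_centralizer T"
  shows "normalizer H \<subseteq> H"
proof
  fix x assume x: "x \<in> normalizer H"
  have "\<lbrakk>t, x\<rbrakk> = 0" if t: "t \<in> T" for t
  proof -
    have "\<lbrakk>t, x\<rbrakk> \<in> H" using x t assms(2) by (auto simp: normalizer_def)
    then have "(bracket t ^^ 2) x = 0"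
      using t assms(3) by (simp add: right_centralizer_def numeral_2_eq_2)
    then show ?thesis
      using assms(1) t semisimple_left_mult_kernel unfolding torus_def by blast
  qed
  then show "x \<in> H" using assms(3) by (simp add: right_centralizer_def)
qed

end

section \<open>Centralizers of maximal tori\<close>

locale finite_dimensional_restricted_leibniz_algebra =
  restricted_leibniz_algebra scale bracket p pmap +
  finite_dimensional_leibniz_algebra scale bracket Basis
  for scale :: "'f::field \<Rightarrow> 'l::ab_group_add \<Rightarrow> 'l" (infixr "*s" 75)
    and bracket :: "'l \<Rightarrow> 'l \<Rightarrow> 'l" ("\<lbrakk>_,/ _\<rbrakk>")
    and p :: nat and pmap :: "'l \<Rightarrow> 'l" and Basis :: "'l set"
begin

lemma some_p_power_semisimple: "\<exists>r. semisimple ((pmap ^^ r) x)"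
proof -
  let ?f = "\<lambda>i. (pmap ^^ i) x"
  obtain r where r: "?f r \<in> span (?f ` {r<..})"
    using sequence_term_in_span_of_later[of ?f] ..
  have "?f ` {r<..} \<subseteq> (\<lambda>i. (pmap ^^ i) (?f r)) ` {0<..}"
  proof clarify
    fix i assume "r < i"
    then have "?f i = (pmap ^^ (i - r)) (?f r)"
      by (metis add.commute comp_apply funpow_add le_add_diff_inverse less_imp_le)
    then show "?f i \<in> (\<lambda>i. (pmap ^^ i) (?f r)) ` {0<..}"
      using \<open>r < i\<close> by (intro image_eqI[of _ _ "i - r"]) auto
  qed
  then have "semisimple (?f r)"
    unfolding semisimple_iff_in_span using r span_mono by blast
  then show ?thesis ..
qed

text \<open>
  The generators commute pairwise, so their span is abelian and the p-mapping is additive on it, that is, semilinear over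
  the Frobenius map. Every generator lies in the span of the image of the p-mapping: the proper iterates of \<open>x\<close> trivially,
  the elements of \<open>T\<close> and \<open>x\<close> itself by semisimplicity. The linear algebra above then makes every
  element of the span semisimple.
\<close>

lemma torus_adjoin_semisimple:
  assumes T: "torus T" and x: "semisimple x" "x \<in> left_centralizer T"
    and right: "left_centralizer T \<subseteq> right_centralizer T"
  shows "torus (span (T \<union> range (\<lambda>i. (pmap ^^ i) x)))" (is "torus ?A")
proof -
  define G where "G = T \<union> range (\<lambda>i. (pmap ^^ i) x)"
  have A: "?A = span G" by (simp add: G_def)
  have TT: "\<lbrakk>s, t\<rbrakk> = 0" if "s \<in> T" "t \<in> T" for s t using that T by (auto simp: torus_def)
  have Tp: "pmap t \<in> T" if "t \<in> T" for t using that T by (auto simp: torus_def p_subalgebra_def)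
  have Gab: "\<lbrakk>a, b\<rbrakk> = 0" if "a \<in> G" "b \<in> G" for a b
    using that TT semisimple_powers_commute[OF x(1)] pmap_left_centralizer[OF x(2)] right
    by (fastforce simp: G_def left_centralizer_def right_centralizer_def)
  have ab: "\<lbrakk>a, b\<rbrakk> = 0" if "a \<in> span G" "b \<in> span G" for a b
  proof -
    have "\<lbrakk>a, b\<rbrakk> \<in> {0}"
    proof (rule bracket_span_in_subspace[OF _ _ that(2)])
      fix b assume b: "b \<in> G"
      show "\<lbrakk>a, b\<rbrakk> \<in> {0}"
        using that(1)
      proof (induction rule: span_induct_alt)
        case (step c u v)
        then show ?case using b Gab by (auto simp: bracket_add_left bracket_scale_left)
      qed auto
    qed auto
    then show ?thesis by simp
  qed
  have add: "pmap (a + b) = pmap a + pmap b" if "a \<in> span G" "b \<in> span G" for a b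
    using that ab by (intro pmap_add_commuting) auto
  have Gp: "pmap a \<in> G" if "a \<in> G" for a
  proof (cases "a \<in> T")
    case False
    then obtain i where "a = (pmap ^^ i) x" using \<open>a \<in> G\<close> by (auto simp: G_def)
    then have "pmap a = (pmap ^^ Suc i) x" by simp
    then show ?thesis unfolding G_def by blast
  qed (auto simp: G_def Tp)
  have inv: "pmap a \<in> span G" if "a \<in> span G" for a
  proof -
    have "a \<in> span G \<and> pmap a \<in> span G"
      using that
    proof (induction rule: span_induct_alt)
      case (step c u v)
      then have u: "c *s u \<in> span G" "pmap u \<in> span G"
        using Gp by (auto intro: span_base span_scale)
      then have "pmap (c *s u + v) = c ^ p *s pmap u + pmap v"
        using step by (simp add: add pmap_scale)
      then show ?case using u step by (auto intro: span_add span_scale)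
    qed (auto simp: span_zero)
    then show ?thesis ..
  qed
  have gen: "span G \<subseteq> span (pmap ` span G)"
  proof (rule span_minimal[OF _ subspace_span], rule subsetI)
    fix a assume a: "a \<in> G"
    show "a \<in> span (pmap ` span G)"
    proof (cases "semisimple a")
      case True
      have G_iter: "(pmap ^^ i) a \<in> G" for i by (induction i) (use a Gp in auto)
      have "(\<lambda>i. (pmap ^^ i) a) ` {0<..} \<subseteq> pmap ` span G"
      proof clarify
        fix i :: nat assume "0 < i"
        then obtain k where "i = Suc k" by (cases i) auto
        then show "(pmap ^^ i) a \<in> pmap ` span G" using G_iter[of k] by (auto intro: span_base)
      qed
      then show ?thesis using True unfolding semisimple_iff_in_span using span_mono by blast
    next
      case False
      then obtain i where i: "a = (pmap ^^ i) x" using a T by (auto simp: G_def torus_def)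
      with False x(1) obtain k where "i = Suc k" by (cases i) auto
      then have "a = pmap ((pmap ^^ k) x)" using i by simp
      then show ?thesis by (auto simp: G_def intro!: span_base imageI)
    qed
  qed
  have "semisimple a" if "a \<in> span G" for a
    unfolding semisimple_iff_in_span
    using semilinear_orbit_in_span[OF subspace_span add pmap_scale pmap_zero _ gen that] inv
    by blast
  then show ?thesis
    unfolding A torus_def p_subalgebra_def subalgebra_def
    using ab inv by (auto simp: span_zero)
qed

lemma semisimple_centralizing_in_maximal_torus:
  assumes "maximal_torus T" "left_centralizer T \<subseteq> right_centralizer T"
    and "semisimple x" "x \<in> left_centralizer T"
  shows "x \<in> T"
proof -
  let ?A = "span (T \<union> range (\<lambda>i. (pmap ^^ i) x))"
  have "torus ?A"
    using assms by (intro torus_adjoin_semisimple) (auto simp: maximal_torus_def)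
  moreover have "T \<subseteq> ?A" by (auto intro: span_base)
  ultimately have "?A = T" using assms(1) by (auto simp: maximal_torus_def)
  moreover have "(pmap ^^ 0) x \<in> ?A" by (intro span_base UnI2 rangeI)
  ultimately show ?thesis by simp
qed

text \<open>
  Some iterate of the p-mapping sends \<open>x \<in> H\<close> into \<open>T\<close>, which annihilates \<open>H = C(T)\<close>; so \<open>L\<^sub>x\<close> is nilpotent on \<open>H\<close>
  and Engel's theorem applies.
\<close>

theorem centralizer_maximal_torus_cartan:
  assumes H: "subalgebra H" and T: "maximal_torus T"
    and left: "H = left_centralizer T" and right: "H = right_centralizer T"
  shows "cartan_subalgebra H"
proof -
  have tor: "torus T" using T by (simp add: maximal_torus_def)
  then have "T \<subseteq> H" by (auto simp: left left_centralizer_def torus_def)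
  have "nilpotent H"
  proof (rule engel[OF H])
    fix x assume "x \<in> H"
    obtain r where "semisimple ((pmap ^^ r) x)" using some_p_power_semisimple ..
    moreover have "(pmap ^^ r) x \<in> left_centralizer T"
      using \<open>x \<in> H\<close> left by (intro pmap_left_centralizer) simp
    moreover have "left_centralizer T \<subseteq> right_centralizer T" using left right by blast
    ultimately have "(pmap ^^ r) x \<in> T"
      using semisimple_centralizing_in_maximal_torus[OF T] by blast
    then have "\<forall>y\<in>H. \<lbrakk>(pmap ^^ r) x, y\<rbrakk> = 0" using right by (simp add: right_centralizer_def)
    then show "\<exists>n. \<forall>y\<in>H. (bracket x ^^ n) y = 0"
      unfolding left_mult_pmap_iter by blast
  qed
  moreover have "H \<subseteq> normalizer H" using H by (auto simp: normalizer_def subalgebra_def)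
  ultimately show ?thesis
    using H normalizer_centralizer_subset[OF tor \<open>T \<subseteq> H\<close> right]
    by (auto simp: cartan_subalgebra_def)
qed

end

theorem theorem5p8:
  fixes scale :: "'f::field \<Rightarrow> 'l::ab_group_add \<Rightarrow> 'l"
    and bracket :: "'l \<Rightarrow> 'l \<Rightarrow> 'l"
    and p :: nat
    and pmap :: "'l \<Rightarrow> 'l"
    and H :: "'l set"
  assumes "restricted_leibniz_algebra scale bracket p pmap"
    and "leibniz_algebra.finite_dimensional scale"
    and "leibniz_algebra.subalgebra scale bracket H"
    and "\<exists>T. restricted_leibniz_algebra.maximal_torus scale bracket pmap T \<and>
             H = leibniz_algebra.left_centralizer bracket T \<and>
             H = leibniz_algebra.right_centralizer bracket T"
  shows "leibniz_algebra.cartan_subalgebra scale bracket H"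
proof -
  interpret restricted_leibniz_algebra scale bracket p pmap by fact
  obtain S where S: "finite S" "span S = UNIV"
    using assms(2) unfolding finite_dimensional_def by blast
  obtain B where B: "independent B" "UNIV \<subseteq> span B"
    using maximal_independent_subset[of UNIV] by blast
  then have "finite B" using independent_span_bound[OF S(1) B(1)] S(2) by simp
  interpret finite_dimensional_restricted_leibniz_algebra scale bracket p pmap B
    by unfold_locales (use B \<open>finite B\<close> in auto)
  show ?thesis
    using assms(3,4) centralizer_maximal_torus_cartan by blast
qed

end
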